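(* Let $\kappa>0$ and $\beta\in(0,1)$ be constants. For $0\le\alpha<\beta$ let $$\mathcal R_\kappa(\alpha):=N^{1-\kappa}\int_\alpha^1t^{-\kappa}\,dt\cdot\frac{\beta}{\beta-\alpha},$$ and for $\beta<\alpha\le1$ let $$\mathcal R_\kappa(\alpha):=N^{1-\kappa}\left(\frac{\beta}{m_\kappa(0)}+\int_\alpha^1t^{-\kappa}\,dt\cdot\frac{m_\kappa'(0)}{m_\kappa(0)^2}\right).$$ Let $\alpha^*$ be the minimizer of $\mathcal R_\kappa$ over the interval $[0,\beta)$. Then $$\limsup_{N\to\infty}\frac{\mathcal R_\kappa(1)}{\mathcal R_\kappa(\alpha^* )}<1.$$ Moreover, $\mathcal R_\kappa(\alpha)/\mathcal R_\kappa(1)\to\infty$ as $\alpha\to\beta^-$.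
   Context: For given $\alpha\in(\beta,1]$ and $z\le0$, $m_\kappa(z)$ (which depends on $\alpha$, $\beta$, $\kappa$) is the smallest positive solution $m$ of $$-z=\frac1m-\frac1\beta\int_{\alpha^{-\kappa}}^\infty\frac{1}{\kappa\,t^{1/\kappa}(1+t\,m)}\,dt,$$ and $m_\kappa'$ is its derivative with respect to $z$. The value $\mathcal R_\kappa(0)$ is $+\infty$ when $\kappa\ge1$. The function $\mathcal R_\kappa$ is the asymptotic risk (the limit in probability, up to a factor $1+o(1)$, of the prediction error averaged over the coefficient vector) of noiseless least squares / minimum $\ell_2$-norm regression on the first $p$ of $N$ independent Gaussian features with variances $\lambda_j=j^{-\kappa}$, with sample size $n$, as $p,n,N\to\infty$ with $p/N\to\alpha$ and $n/N\to\beta$; the claim itself concerns only the functions displayed. *)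

theory Defs
  imports "HOL-Analysis.Analysis"
begin

text \<open>
  Only meaningful for \<open>\<beta> < \<alpha> \<le> 1\<close> and \<open>z \<le> 0\<close>; on the reals, \<open>LEAST\<close> denotes the
  minimum of the set of positive solutions.
\<close>

definition m_sol :: "real \<Rightarrow> real \<Rightarrow> real \<Rightarrow> real \<Rightarrow> real" where
  "m_sol \<kappa> \<beta> \<alpha> z = (LEAST m. 0 < m \<and>
     - z = 1 / m - 1 / \<beta> *
       (LINT t:{\<alpha> powr (- \<kappa>)..}|lborel. 1 / (\<kappa> * t powr (1 / \<kappa>) * (1 + t * m))))"

text \<open>
  Since \<open>m_sol\<close> is only specified for \<open>z \<le> 0\<close>, its derivative at \<open>0\<close> is the left one.
\<close>

definition m_sol_deriv0 :: "real \<Rightarrow> real \<Rightarrow> real \<Rightarrow> real" where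
  "m_sol_deriv0 \<kappa> \<beta> \<alpha> = vector_derivative (m_sol \<kappa> \<beta> \<alpha>) (at 0 within {..0})"

text \<open>
  The integral of a nonnegative function is taken in the extended sense, so that it is
  \<open>\<infinity>\<close> for \<open>\<alpha> = 0\<close> and \<open>\<kappa> \<ge> 1\<close>.
\<close>

definition tail_integral :: "real \<Rightarrow> real \<Rightarrow> ereal" where
  "tail_integral \<kappa> \<alpha> = enn2ereal (\<integral>\<^sup>+ t \<in> {\<alpha>..1}. ennreal (t powr (- \<kappa>)) \<partial>lborel)"

text \<open>
  Specified for \<open>N \<ge> 1\<close> and \<open>\<alpha> \<in> {0..1} - {\<beta>}\<close>; the value at \<open>\<alpha> = \<beta>\<close> is irrelevant.
\<close>

definition risk :: "real \<Rightarrow> real \<Rightarrow> nat \<Rightarrow> real \<Rightarrow> ereal" where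
  "risk \<kappa> \<beta> N \<alpha> =
     (if \<alpha> < \<beta>
      then ereal (real N powr (1 - \<kappa>)) * (tail_integral \<kappa> \<alpha> * ereal (\<beta> / (\<beta> - \<alpha>)))
      else ereal (real N powr (1 - \<kappa>)) *
        (ereal (\<beta> / m_sol \<kappa> \<beta> \<alpha> 0) +
         tail_integral \<kappa> \<alpha> * ereal (m_sol_deriv0 \<kappa> \<beta> \<alpha> / (m_sol \<kappa> \<beta> \<alpha> 0)\<^sup>2)))"

definition alpha_star :: "real \<Rightarrow> real \<Rightarrow> nat \<Rightarrow> real" where
  "alpha_star \<kappa> \<beta> N = arg_min_on (risk \<kappa> \<beta> N) {0..<\<beta>}"

end

theory Submission
  imports Defs "HOL-Real_Asymp.Real_Asymp"
begin

text \<open>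
  Write \<open>F a\<close> for the integral of \<open>t powr (- \<kappa>)\<close> over \<open>{a..1}\<close>. A point \<open>y\<close> with
  \<open>F y = y powr (- \<kappa>) * (\<beta> - y)\<close> exists by the intermediate value theorem, and the tangent
  of the strictly convex function \<open>F\<close> at \<open>y\<close> is then the line \<open>y powr (- \<kappa>) * (\<beta> - x)\<close>;
  hence \<open>F x / (\<beta> - x)\<close> has its unique minimum over \<open>{0..<\<beta>}\<close> at \<open>y\<close>.

  At \<open>\<alpha> = 1\<close> only the term \<open>\<beta> / m\<close> of the risk survives. After the substitution
  \<open>t = s powr (- \<kappa>)\<close> the equation for \<open>m\<close> says that \<open>\<beta>\<close> is the integral of
  \<open>m / (s powr \<kappa> + m)\<close> over \<open>{0..1}\<close>. Bounding the integrand by \<open>1\<close> for \<open>s < a\<close> and strictly by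
  \<open>m * s powr (- \<kappa>)\<close> for \<open>s > a\<close> yields \<open>\<beta> - a < m * F a\<close>, which at \<open>a = y\<close> says that
  \<open>\<beta> / m\<close> is less than the minimal risk \<open>F y * \<beta> / (\<beta> - y)\<close>.
\<close>

section \<open>Closed form of the tail integral and its tangents\<close>

definition power_tail :: "real \<Rightarrow> real \<Rightarrow> real" where
  "power_tail \<kappa> a = (if \<kappa> = 1 then - ln a else (1 - a powr (1 - \<kappa>)) / (1 - \<kappa>))"

lemma power_tail_1 [simp]: "power_tail \<kappa> 1 = 0"
  by (simp add: power_tail_def)

lemma DERIV_power_tail:
  assumes "0 < a"
  shows "(power_tail \<kappa> has_real_derivative - (a powr (- \<kappa>))) (at a)"
proof (cases "\<kappa> = 1")
  case True
  have "((\<lambda>a. - ln a) has_real_derivative - (a powr (- 1))) (at a)"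
    using assms by (auto intro!: derivative_eq_intros simp: powr_minus field_simps)
  then show ?thesis
    using True by (simp add: power_tail_def[abs_def])
next
  case False
  have "((\<lambda>a. (1 - a powr (1 - \<kappa>)) / (1 - \<kappa>)) has_real_derivative
      (0 - (1 - \<kappa>) * a powr (1 - \<kappa> - 1)) / (1 - \<kappa>)) (at a)"
    by (intro DERIV_cdivide DERIV_diff DERIV_const has_real_derivative_powr assms)
  then show ?thesis
    using False by (simp add: power_tail_def[abs_def])
qed

lemma continuous_on_power_tail: "A \<subseteq> {0<..} \<Longrightarrow> continuous_on A (power_tail \<kappa>)"
  by (intro continuous_at_imp_continuous_on ballI DERIV_isCont[OF DERIV_power_tail]) auto

text \<open>By the mean value theorem the chord between \<open>x\<close> and \<open>y\<close> has
  slope \<open>- (z powr (- \<kappa>))\<close> for some \<open>z\<close> strictly between them, and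
  \<kappa> > 0 makes this slope strictly increasing in \<open>z\<close>.\<close>

lemma power_tail_tangent:
  assumes "0 < \<kappa>" "0 < x" "0 < y" "x \<noteq> y"
  shows "power_tail \<kappa> x > power_tail \<kappa> y + y powr (- \<kappa>) * (y - x)"
proof (cases "x < y")
  case True
  obtain z where z: "x < z" "z < y"
    and eq: "power_tail \<kappa> y - power_tail \<kappa> x = (y - x) * - (z powr (- \<kappa>))"
    using MVT2[OF True, of "power_tail \<kappa>" "\<lambda>a. - (a powr (- \<kappa>))"] DERIV_power_tail assms by force
  have "y powr (- \<kappa>) < z powr (- \<kappa>)"
    using z assms by (intro powr_less_mono2_neg) auto
  then have "y powr (- \<kappa>) * (y - x) < z powr (- \<kappa>) * (y - x)"
    using True by simp
  then show ?thesis
    using eq by (simp add: algebra_simps)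
next
  case False
  then have "y < x"
    using assms by simp
  then obtain z where z: "y < z" "z < x"
    and eq: "power_tail \<kappa> x - power_tail \<kappa> y = (x - y) * - (z powr (- \<kappa>))"
    using MVT2[of y x "power_tail \<kappa>" "\<lambda>a. - (a powr (- \<kappa>))"] DERIV_power_tail assms by force
  have "z powr (- \<kappa>) < y powr (- \<kappa>)"
    using z assms by (intro powr_less_mono2_neg) auto
  then have "z powr (- \<kappa>) * (x - y) < y powr (- \<kappa>) * (x - y)"
    using \<open>y < x\<close> by simp
  then show ?thesis
    using eq by (simp add: algebra_simps)
qed

lemma power_tail_pos:
  assumes "0 < \<kappa>" "0 < x" "x < 1"
  shows "0 < power_tail \<kappa> x"
  using power_tail_tangent[of \<kappa> x 1] assms by simp

lemma power_tail_antimono: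
  assumes "0 < x" "x \<le> y"
  shows "power_tail \<kappa> y \<le> power_tail \<kappa> x"
proof (rule DERIV_nonpos_imp_nonincreasing[OF assms(2)])
  show "\<exists>d. (power_tail \<kappa> has_real_derivative d) (at z) \<and> d \<le> 0" if "x \<le> z" for z
    using that assms by (intro exI[of _ "- (z powr (- \<kappa>))"] conjI DERIV_power_tail) auto
qed

text \<open>The negative of \<open>power_tail\<close> is an antiderivative on \<open>{x..1}\<close>.
  At 0 the closed form fails for \<kappa> \<ge> 1, where the integral is infinite; hence the
  hypothesis \<open>0 < x\<close>.\<close>

lemma tail_integral_eq:
  assumes "0 < x" "x \<le> 1"
  shows "tail_integral \<kappa> x = ereal (power_tail \<kappa> x)"
proof -
  have "(\<integral>\<^sup>+ t. ennreal (t powr (- \<kappa>)) * indicator {x..1} t \<partial>lborel)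
    = ennreal (- power_tail \<kappa> 1 - - power_tail \<kappa> x)"
    by (rule nn_integral_FTC_Icc)
       (use assms in \<open>auto intro!: derivative_eq_intros DERIV_power_tail
          intro: has_field_derivative_at_within\<close>)
  then show ?thesis
    using power_tail_antimono[OF assms, of \<kappa>]
    by (simp add: tail_integral_def)
qed

lemma tail_integral_antimono: "x \<le> y \<Longrightarrow> tail_integral \<kappa> y \<le> tail_integral \<kappa> x"
  unfolding tail_integral_def less_eq_ennreal.rep_eq[symmetric]
  by (intro nn_integral_mono) (auto simp: indicator_def)

text \<open>Carries the strict tangent bound over to \<open>x = 0\<close>, where the tail may be
  infinite. Letting \<open>x\<close> tend to 0 would lose strictness, so a fixed gap at
  \<open>y / 2\<close> is propagated to a small \<open>e > 0\<close>, and antitonicity passes from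
  \<open>e\<close> to 0.\<close>

lemma tail_integral_tangent:
  assumes "0 < \<kappa>" "0 \<le> x" "x \<le> 1" "0 < y" "y \<le> 1" "x \<noteq> y"
  shows "tail_integral \<kappa> x > ereal (power_tail \<kappa> y + y powr (- \<kappa>) * (y - x))"
proof (cases "x = 0")
  case False
  then show ?thesis
    using assms power_tail_tangent[of \<kappa> x y] by (simp add: tail_integral_eq)
next
  case True
  define c where "c = y powr (- \<kappa>)"
  have c: "c > 0"
    using assms by (simp add: c_def)
  \<comment> \<open>The gap between \<open>power_tail\<close> and its tangent at \<open>y\<close>,
    measured at \<open>y / 2\<close>.\<close>
  define d where "d = power_tail \<kappa> (y / 2) - (power_tail \<kappa> y + c * (y / 2))"
  have d: "d > 0"
    using power_tail_tangent[of \<kappa> "y / 2" y] assms by (simp add: d_def c_def)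
  \<comment> \<open>Left of \<open>y / 2\<close> the gap to the tangent at \<open>y\<close> shrinks
    by at most \<open>c * e\<close>, and \<open>e\<close> is chosen to make this less than
    \<open>d\<close>.\<close>
  define e where "e = min (y / 4) (d / (2 * c))"
  have e: "0 < e" "e < y / 2" "c * e < d"
    using assms c d by (auto simp: e_def field_simps min_def)
  have "(y / 2) powr (- \<kappa>) \<ge> c"
    unfolding c_def using assms by (intro powr_mono2') auto
  then have "c * (y / 2 - e) \<le> (y / 2) powr (- \<kappa>) * (y / 2 - e)"
    using e by (intro mult_right_mono) auto
  also have "\<dots> < power_tail \<kappa> e - power_tail \<kappa> (y / 2)"
    using power_tail_tangent[of \<kappa> e "y / 2"] e assms by simp
  finally have "power_tail \<kappa> y + c * y < power_tail \<kappa> e"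
    using e(3) unfolding d_def by (simp add: algebra_simps)
  then have "ereal (power_tail \<kappa> y + c * y) < tail_integral \<kappa> e"
    using e assms by (simp add: tail_integral_eq)
  also have "\<dots> \<le> tail_integral \<kappa> 0"
    using e by (intro tail_integral_antimono) auto
  finally show ?thesis
    using True by (simp add: c_def)
qed

section \<open>Existence of the critical point\<close>

lemma powr_mult_power_tail_at_0:
  assumes "0 < \<kappa>"
  shows "((\<lambda>x. x powr \<kappa> * power_tail \<kappa> x) \<longlongrightarrow> 0) (at_right 0)"
proof (cases "\<kappa> = 1")
  case True
  have "((\<lambda>x::real. x powr 1 * - ln x) \<longlongrightarrow> 0) (at_right 0)"
    by real_asymp
  then show ?thesis
    using True by (simp add: power_tail_def)
next
  case False
  \<comment> \<open>For \<kappa> \<noteq> 1 the two powers in the product combine to this quotient,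
    in which both exponents are positive.\<close>
  have "((\<lambda>x::real. (x powr \<kappa> - x) / (1 - \<kappa>)) \<longlongrightarrow> (0 - 0) / (1 - \<kappa>)) (at_right 0)"
  proof (intro tendsto_intros)
    show "((\<lambda>x. x powr \<kappa>) \<longlongrightarrow> 0) (at_right 0)"
      using assms by real_asymp
  qed (use False in auto)
  moreover have "\<forall>\<^sub>F x in at_right 0. (x powr \<kappa> - x) / (1 - \<kappa>) = x powr \<kappa> * power_tail \<kappa> x"
    using eventually_at_right_less[of "0::real"]
  proof eventually_elim
    case (elim x)
    have "x powr \<kappa> * x powr (1 - \<kappa>) = x"
      using elim by (simp flip: powr_add)
    then show ?case
      using False by (simp add: power_tail_def field_simps)
  qed
  ultimately have "((\<lambda>x. x powr \<kappa> * power_tail \<kappa> x) \<longlongrightarrow> (0 - 0) / (1 - \<kappa>)) (at_right 0)"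
    by (rule Lim_transform_eventually)
  then show ?thesis
    by simp
qed

text \<open>The first-order condition for a minimum of \<open>power_tail \<kappa> y / (\<beta> - y)\<close>.\<close>

lemma critical_point_exists:
  assumes "0 < \<kappa>" "0 < \<beta>" "\<beta> < 1"
  obtains y where "0 < y" "y < \<beta>" "power_tail \<kappa> y = y powr (- \<kappa>) * (\<beta> - y)"
proof -
  \<comment> \<open>The condition multiplied by \<open>x powr \<kappa>\<close>: this tames the
    blow-up at 0, where \<open>f\<close> tends to \<beta> > 0, while \<open>f \<beta>\<close> is
    negative because the tail at \<beta> < 1 is positive.\<close>
  define f where "f x = \<beta> - x - x powr \<kappa> * power_tail \<kappa> x" for x
  have "(f \<longlongrightarrow> \<beta> - 0 - 0) (at_right 0)"
    unfolding f_def by (intro tendsto_intros powr_mult_power_tail_at_0 assms)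
  then have "\<forall>\<^sub>F x in at_right 0. f x > 0"
    using assms by (intro order_tendstoD(1)[where y = \<beta>]) auto
  moreover have "\<forall>\<^sub>F x in at_right 0. x < \<beta>"
    using assms by (intro order_tendstoD(2)[OF tendsto_ident_at]) auto
  ultimately have "\<forall>\<^sub>F x in at_right 0. f x > 0 \<and> x < \<beta> \<and> 0 < x"
    using eventually_at_right_less[of "0::real"] by eventually_elim auto
  then obtain a where a: "f a > 0" "a < \<beta>" "0 < a"
    using eventually_happens'[OF trivial_limit_at_right_real] by blast
  have neg: "f \<beta> < 0"
    using power_tail_pos[of \<kappa> \<beta>] assms by (simp add: f_def)
  have "continuous_on {a..\<beta>} f"
    unfolding f_def using a by (intro continuous_intros continuous_on_power_tail) auto
  then obtain y where y: "a \<le> y" "y \<le> \<beta>" "f y = 0"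
    using IVT2'[of f \<beta> 0 a] a neg by auto
  have "y \<noteq> \<beta>"
    using y neg by auto
  moreover have "power_tail \<kappa> y = y powr (- \<kappa>) * (\<beta> - y)"
    using y a by (simp add: f_def powr_minus field_simps)
  ultimately show ?thesis
    using that[of y] y a by auto
qed

section \<open>The integral in the equation for \<open>m\<close>, as a function of
  \<open>m\<close>\<close>

text \<open>Under \<open>t = s powr (- \<kappa>)\<close>, Lebesgue measure on \<open>s \<in> {0<..1}\<close> becomes this density on \<open>{1..}\<close>.\<close>

definition pareto_density :: "real \<Rightarrow> real \<Rightarrow> real" where
  "pareto_density \<kappa> t = t powr (- 1 / \<kappa> - 1) / \<kappa>"

text \<open>In the variable \<open>s\<close> this is the integral of
  \<open>m / (s powr \<kappa> + m)\<close> over \<open>{0..1}\<close>. The factor multiplying the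
  density stays in [0,1] for \<open>m \<ge> 0\<close>.\<close>

definition stieltjes_mass :: "real \<Rightarrow> real \<Rightarrow> real" where
  "stieltjes_mass \<kappa> m = (LINT t:{1..}|lborel. pareto_density \<kappa> t * (t * m / (1 + t * m)))"

lemma pareto_density_nonneg: "0 < \<kappa> \<Longrightarrow> 0 \<le> pareto_density \<kappa> t"
  by (simp add: pareto_density_def)

lemma measurable_pareto_density [measurable]: "pareto_density \<kappa> \<in> borel_measurable borel"
  unfolding pareto_density_def[abs_def] by measurable

lemma has_bochner_integral_pareto_density:
  assumes "0 < \<kappa>" "0 < A"
  shows "has_bochner_integral lborel (\<lambda>t. pareto_density \<kappa> t * indicator {A..} t) (A powr (- 1 / \<kappa>))"
proof (rule has_bochner_integral_nn_integral)
  have "(\<integral>\<^sup>+ t. ennreal (pareto_density \<kappa> t) * indicator {A..} t \<partial>lborel)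
      = ennreal (0 - - (A powr (- 1 / \<kappa>)))"
  proof (rule nn_integral_FTC_atLeast)
    show "((\<lambda>t. - (t powr (- 1 / \<kappa>))) has_real_derivative pareto_density \<kappa> t) (at t)"
      if "A \<le> t" for t
      using that assms DERIV_minus[OF has_real_derivative_powr[of t "- 1 / \<kappa>"]]
      by (simp add: pareto_density_def)
    show "((\<lambda>t. - (t powr (- 1 / \<kappa>))) \<longlongrightarrow> 0) at_top"
      using assms by real_asymp
  qed (use assms in \<open>auto simp: pareto_density_nonneg\<close>)
  then show "(\<integral>\<^sup>+ t. ennreal (pareto_density \<kappa> t * indicator {A..} t) \<partial>lborel)
      = ennreal (A powr (- 1 / \<kappa>))"
    by (simp add: ennreal_mult'' ennreal_indicator[symmetric] cong: nn_integral_cong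
        flip: ennreal_indicator)
qed (use assms in \<open>auto simp: pareto_density_nonneg\<close>)

text \<open>In the variable \<open>s\<close> this is the integral of
  \<open>s powr (- \<kappa>)\<close> over \<open>{a..1}\<close>; accordingly
  \<open>power_tail\<close> composed with \<open>t powr (- 1 / \<kappa>)\<close> is an
  antiderivative.\<close>

lemma has_bochner_integral_mult_pareto_density:
  assumes "0 < \<kappa>" "0 < a" "a \<le> 1"
  shows "has_bochner_integral lborel
    (\<lambda>t. (t * pareto_density \<kappa> t) * indicator {1..a powr (- \<kappa>)} t) (power_tail \<kappa> a)"
proof -
  have le: "1 \<le> a powr (- \<kappa>)"
    using assms ge_one_powr_ge_zero[of "1 / a" \<kappa>] by (simp add: powr_minus powr_divide inverse_eq_divide)
  have "has_bochner_integral lborel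
    (\<lambda>t. (t * pareto_density \<kappa> t) * indicator {1..a powr (- \<kappa>)} t)
    (power_tail \<kappa> ((a powr (- \<kappa>)) powr (- 1 / \<kappa>)) - power_tail \<kappa> (1 powr (- 1 / \<kappa>)))"
  proof (rule has_bochner_integral_FTC_Icc_nonneg)
    fix t :: real
    assume "t \<in> {1..a powr (- \<kappa>)}"
    then have t: "1 \<le> t"
      by simp
    have "(t powr (- 1 / \<kappa>)) powr (- \<kappa>) = t"
      using assms t by (simp add: powr_powr)
    moreover have "((\<lambda>t. power_tail \<kappa> (t powr (- 1 / \<kappa>))) has_real_derivative
        - ((t powr (- 1 / \<kappa>)) powr (- \<kappa>)) * (- 1 / \<kappa> * t powr (- 1 / \<kappa> - 1))) (at t)"
      using t by (intro DERIV_chain2[OF DERIV_power_tail] has_real_derivative_powr) auto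
    ultimately show "((\<lambda>t. power_tail \<kappa> (t powr (- 1 / \<kappa>))) has_real_derivative t * pareto_density \<kappa> t) (at t)"
      by (simp add: pareto_density_def)
  qed (use le assms in \<open>auto simp: pareto_density_nonneg\<close>)
  then show ?thesis
    using assms by (simp add: powr_powr)
qed

text \<open>A majorant independent of \<open>m\<close>, for the dominated convergence arguments at
  finite \<open>m\<close> and at infinity.\<close>

lemma pareto_mass_bounds:
  fixes t m :: real
  assumes "0 < \<kappa>" "0 \<le> m"
  shows "norm (indicator {1..} t *\<^sub>R (pareto_density \<kappa> t * (t * m / (1 + t * m))))
    \<le> pareto_density \<kappa> t * indicator {1..} t"
proof (cases "1 \<le> t")
  case True
  then have "0 \<le> t * m"
    using assms by simp
  then have "t * m / (1 + t * m) \<le> 1" "0 \<le> t * m / (1 + t * m)"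
    by (auto simp: field_simps)
  then show ?thesis
    using True pareto_density_nonneg[OF assms(1), of t]
    by (simp only: indicator_simps atLeast_iff real_norm_def abs_mult scaleR_one abs_of_nonneg mult_1_right
        mult_left_le)
qed auto

lemma continuous_on_stieltjes_mass:
  assumes "0 < \<kappa>"
  shows "continuous_on {0..} (stieltjes_mass \<kappa>)"
  unfolding continuous_on_sequentially
proof (intro allI ballI impI, elim conjE)
  fix X :: "nat \<Rightarrow> real" and m
  assume m: "m \<in> {0..}" and X: "\<forall>n. X n \<in> {0..}" "X \<longlonglongrightarrow> m"
  show "(stieltjes_mass \<kappa> \<circ> X) \<longlonglongrightarrow> stieltjes_mass \<kappa> m"
    unfolding stieltjes_mass_def set_lebesgue_integral_def comp_def
  proof (rule integral_dominated_convergence)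
    show "integrable lborel (\<lambda>t. pareto_density \<kappa> t * indicator {1..} t)"
      using has_bochner_integral_pareto_density[OF assms, of 1] by (auto simp: has_bochner_integral_iff)
    have "(\<lambda>n. indicator {1..} t *\<^sub>R (pareto_density \<kappa> t * (t * X n / (1 + t * X n))))
        \<longlonglongrightarrow> indicator {1..} t *\<^sub>R (pareto_density \<kappa> t * (t * m / (1 + t * m)))" for t :: real
    proof (cases "1 \<le> t")
      case True
      then have "0 \<le> t * m"
        using m by simp
      then show ?thesis
        by (intro tendsto_intros X) auto
    qed auto
    then show "AE t in lborel.
        (\<lambda>n. indicator {1..} t *\<^sub>R (pareto_density \<kappa> t * (t * X n / (1 + t * X n))))
        \<longlonglongrightarrow> indicator {1..} t *\<^sub>R (pareto_density \<kappa> t * (t * m / (1 + t * m)))"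
      by simp
    show "AE t in lborel. norm (indicator {1..} t *\<^sub>R (pareto_density \<kappa> t * (t * X n / (1 + t * X n))))
        \<le> pareto_density \<kappa> t * indicator {1..} t" for n
      using pareto_mass_bounds[OF assms, of "X n"] X by auto
  qed measurable
qed

lemma stieltjes_mass_0 [simp]: "stieltjes_mass \<kappa> 0 = 0"
  by (simp add: stieltjes_mass_def set_lebesgue_integral_def)

text \<open>The integrand tends pointwise to the density, whose total mass is 1. Together with the
  value 0 at 0 this lets every level \<beta> in (0,1) be attained.\<close>

lemma stieltjes_mass_at_top:
  assumes "0 < \<kappa>"
  shows "(stieltjes_mass \<kappa> \<longlongrightarrow> 1) at_top"
proof -
  have *: "has_bochner_integral lborel (\<lambda>t. pareto_density \<kappa> t * indicator {1..} t) 1"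
    using has_bochner_integral_pareto_density[OF assms, of 1] by simp
  have "(stieltjes_mass \<kappa> \<longlongrightarrow> integral\<^sup>L lborel (\<lambda>t. pareto_density \<kappa> t * indicator {1..} t)) at_top"
    unfolding stieltjes_mass_def[abs_def] set_lebesgue_integral_def
  proof (rule integral_dominated_convergence_at_top)
    show "integrable lborel (\<lambda>t. pareto_density \<kappa> t * indicator {1..} t)"
      using * by (auto simp: has_bochner_integral_iff)
    have "((\<lambda>m. indicator {1..} t *\<^sub>R (pareto_density \<kappa> t * (t * m / (1 + t * m))))
        \<longlongrightarrow> pareto_density \<kappa> t * indicator {1..} t) at_top" for t :: real
    proof (cases "1 \<le> t")
      case True
      then have "((\<lambda>m. t * m / (1 + t * m)) \<longlongrightarrow> 1) at_top"
        by real_asymp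
      then have "((\<lambda>m. pareto_density \<kappa> t * (t * m / (1 + t * m))) \<longlongrightarrow> pareto_density \<kappa> t * 1) at_top"
        by (intro tendsto_intros)
      then show ?thesis
        using True by simp
    qed auto
    then show "AE t in lborel. ((\<lambda>m. indicator {1..} t *\<^sub>R (pareto_density \<kappa> t * (t * m / (1 + t * m))))
        \<longlongrightarrow> pareto_density \<kappa> t * indicator {1..} t) at_top"
      by simp
    show "\<forall>\<^sub>F m in at_top. AE t in lborel.
        norm (indicator {1..} t *\<^sub>R (pareto_density \<kappa> t * (t * m / (1 + t * m))))
        \<le> pareto_density \<kappa> t * indicator {1..} t"
      using eventually_ge_at_top[of "0::real"]
      by eventually_elim (simp only: pareto_mass_bounds[OF assms] AE_I2)
  qed measurable
  then show ?thesis
    using * by (simp add: has_bochner_integral_iff)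
qed

text \<open>Bounds \<open>t * m / (1 + t * m)\<close> by \<open>m / (1 + m) * t\<close> for \<open>t \<le> a powr (- \<kappa>)\<close> and by \<open>1\<close> beyond.\<close>

lemma stieltjes_mass_le:
  assumes "0 < \<kappa>" "0 < a" "a \<le> 1" "0 \<le> m"
  shows "stieltjes_mass \<kappa> m \<le> m / (1 + m) * power_tail \<kappa> a + a"
proof -
  define A where "A = a powr (- \<kappa>)"
  have A: "0 < A" "A powr (- 1 / \<kappa>) = a"
    using assms by (auto simp: A_def powr_powr)
  have "has_bochner_integral lborel
      (\<lambda>t. m / (1 + m) * ((t * pareto_density \<kappa> t) * indicator {1..A} t) + pareto_density \<kappa> t * indicator {A..} t)
      (m / (1 + m) * power_tail \<kappa> a + a)"
    using has_bochner_integral_mult_pareto_density[OF assms(1-3)]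
      has_bochner_integral_pareto_density[OF assms(1) A(1)]
    unfolding A(2) A_def[symmetric]
    by (intro has_bochner_integral_add has_bochner_integral_mult_right)
  note bound = this[unfolded has_bochner_integral_iff]
  have "stieltjes_mass \<kappa> m \<le> integral\<^sup>L lborel
      (\<lambda>t. m / (1 + m) * ((t * pareto_density \<kappa> t) * indicator {1..A} t) + pareto_density \<kappa> t * indicator {A..} t)"
    unfolding stieltjes_mass_def set_lebesgue_integral_def
  proof (rule integral_mono')
    fix t :: real
    have w: "0 \<le> pareto_density \<kappa> t"
      using assms by (simp add: pareto_density_nonneg)
    have "t * m / (1 + t * m) \<le> m / (1 + m) * t" if "1 \<le> t"
    proof -
      \<comment> \<open>From \<open>t \<ge> 1\<close> the denominator is at least
        \<open>1 + m\<close>. Keeping \<open>1 + m\<close> instead of 1 is what later makes the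
        bound on \<beta> strict.\<close>
      have "m \<le> t * m"
        using that assms by (simp add: mult_le_cancel_right1)
      then have "t * m / (1 + t * m) \<le> t * m / (1 + m)"
        using that assms by (intro divide_left_mono) auto
      then show ?thesis
        by (simp add: mult.commute)
    qed
    then have "pareto_density \<kappa> t * (t * m / (1 + t * m)) \<le> m / (1 + m) * (t * pareto_density \<kappa> t)" if "1 \<le> t"
      using that mult_left_mono[OF _ w] by (fastforce simp: algebra_simps)
    moreover have "pareto_density \<kappa> t * (t * m / (1 + t * m)) \<le> pareto_density \<kappa> t" if "1 \<le> t"
      using order_trans[OF abs_ge_self pareto_mass_bounds[OF assms(1,4), of t, unfolded real_norm_def]] that
      by simp
    moreover have "0 \<le> m / (1 + m) * (t * pareto_density \<kappa> t)" if "1 \<le> t"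
      using that w assms by simp
    ultimately show "indicator {1..} t *\<^sub>R (pareto_density \<kappa> t * (t * m / (1 + t * m)))
        \<le> m / (1 + m) * ((t * pareto_density \<kappa> t) * indicator {1..A} t) + pareto_density \<kappa> t * indicator {A..} t"
      \<comment> \<open>At \<open>t = A\<close> both indicators are 1; either summand suffices there
        since both are nonnegative.\<close>
      using w by (cases "t < A"; cases "t = A") (auto simp: indicator_def intro: add_increasing2)
    show "0 \<le> m / (1 + m) * ((t * pareto_density \<kappa> t) * indicator {1..A} t) + pareto_density \<kappa> t * indicator {A..} t"
      using w assms by (auto simp: indicator_def)
  qed (use bound in auto)
  then show ?thesis
    using bound by simp
qed

section \<open>The least positive solution at \<alpha> = 1 and z = 0\<close>

lemma stieltjes_equation_iff:
  assumes "0 < \<kappa>" "0 < \<beta>" "0 < m"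
  shows "- 0 = 1 / m - 1 / \<beta> *
       (LINT t:{1 powr (- \<kappa>)..}|lborel. 1 / (\<kappa> * t powr (1 / \<kappa>) * (1 + t * m)))
    \<longleftrightarrow> stieltjes_mass \<kappa> m = \<beta>"
proof -
  have "indicator {1..} t *\<^sub>R (pareto_density \<kappa> t * (t * m / (1 + t * m)))
      = m * (indicator {1..} t *\<^sub>R (1 / (\<kappa> * t powr (1 / \<kappa>) * (1 + t * m))))" for t :: real
  proof (cases "1 \<le> t")
    case True
    then have eq: "t powr (- 1 / \<kappa> - 1) * t = 1 / t powr (1 / \<kappa>)"
      by (simp add: powr_diff powr_minus_divide)
    have "pareto_density \<kappa> t * (t * m / (1 + t * m))
        = (t powr (- 1 / \<kappa> - 1) * t) * (m / (\<kappa> * (1 + t * m)))"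
      by (simp add: pareto_density_def)
    then show ?thesis
      unfolding eq using True by (simp add: mult.commute mult.left_commute)
  qed auto
  then have "stieltjes_mass \<kappa> m
      = m * (LINT t:{1 powr (- \<kappa>)..}|lborel. 1 / (\<kappa> * t powr (1 / \<kappa>) * (1 + t * m)))"
    by (simp only: stieltjes_mass_def set_lebesgue_integral_def powr_one_eq_one integral_mult_right_zero)
  then show ?thesis
    using assms by (auto simp: field_simps)
qed

text \<open>\<open>LEAST\<close> is informative only if a minimum is attained. The intermediate
  value theorem gives a solution in \<open>{0..M}\<close>, and the solutions there form a compact
  set, which has a least element; it is positive because the mass at 0 is 0.\<close>

lemma m_sol_1_0:
  assumes "0 < \<kappa>" "0 < \<beta>" "\<beta> < 1"
  shows "0 < m_sol \<kappa> \<beta> 1 0 \<and> stieltjes_mass \<kappa> (m_sol \<kappa> \<beta> 1 0) = \<beta>"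
proof -
  have "\<forall>\<^sub>F m in at_top. \<beta> < stieltjes_mass \<kappa> m"
    using assms by (intro order_tendstoD(1)[OF stieltjes_mass_at_top]) auto
  then have "\<forall>\<^sub>F m in at_top. \<beta> < stieltjes_mass \<kappa> m \<and> 0 \<le> m"
    using eventually_ge_at_top[of "0::real"] by eventually_elim auto
  then obtain M where M: "\<beta> < stieltjes_mass \<kappa> M" "0 \<le> M"
    using eventually_happens'[OF trivial_limit_at_top_linorder] by blast
  have cont: "continuous_on {0..M} (stieltjes_mass \<kappa>)"
    by (rule continuous_on_subset[OF continuous_on_stieltjes_mass[OF assms(1)]]) auto
  define S where "S = {m \<in> {0..M}. stieltjes_mass \<kappa> m = \<beta>}"
  have "S \<noteq> {}"
    using IVT'[of "stieltjes_mass \<kappa>" 0 \<beta> M] M cont assms by (auto simp: S_def)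
  moreover have "compact S"
    unfolding compact_eq_bounded_closed S_def
    by (intro conjI bounded_subset[OF bounded_closed_interval]
        continuous_closed_preimage_constant[OF cont]) auto
  ultimately obtain m where m: "m \<in> S" "\<And>x. x \<in> S \<Longrightarrow> m \<le> x"
    using compact_attains_inf by metis
  have mass: "stieltjes_mass \<kappa> m = \<beta>" "0 \<le> m" "m \<le> M"
    using m by (auto simp: S_def)
  have pos: "0 < m"
    using mass assms by (cases "m = 0") auto
  have "m_sol \<kappa> \<beta> 1 0 = m"
    unfolding m_sol_def
  proof (rule Least_equality)
    show "0 < m \<and> - 0 = 1 / m - 1 / \<beta> *
       (LINT t:{1 powr (- \<kappa>)..}|lborel. 1 / (\<kappa> * t powr (1 / \<kappa>) * (1 + t * m)))"
      using pos mass by (subst stieltjes_equation_iff[OF assms(1,2) pos]) auto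
    fix x
    assume x: "0 < x \<and> - 0 = 1 / x - 1 / \<beta> *
       (LINT t:{1 powr (- \<kappa>)..}|lborel. 1 / (\<kappa> * t powr (1 / \<kappa>) * (1 + t * x)))"
    then have "stieltjes_mass \<kappa> x = \<beta>"
      using stieltjes_equation_iff[OF assms(1,2)] by blast
    \<comment> \<open>Solutions beyond \<open>M\<close> exceed \<open>m\<close> since
      \<open>m \<le> M\<close>.\<close>
    then show "m \<le> x"
      using m(2)[of x] x mass(3) by (cases "x \<le> M") (auto simp: S_def)
  qed
  then show ?thesis
    using pos mass by simp
qed

text \<open>The mass bound is applied at the solution, where the mass equals \<beta>; strictness
  comes from \<open>m / (1 + m) < m\<close> and the positivity of the tail for
  \<open>a < 1\<close>.\<close>

lemma less_m_sol_mult_power_tail: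
  assumes "0 < \<kappa>" "0 < \<beta>" "\<beta> < 1" "0 < a" "a < 1"
  shows "\<beta> - a < m_sol \<kappa> \<beta> 1 0 * power_tail \<kappa> a"
proof -
  define m where "m = m_sol \<kappa> \<beta> 1 0"
  have m: "0 < m" "stieltjes_mass \<kappa> m = \<beta>"
    using m_sol_1_0[OF assms(1-3)] by (auto simp: m_def)
  have "\<beta> \<le> m / (1 + m) * power_tail \<kappa> a + a"
    using stieltjes_mass_le[of \<kappa> a m] m assms by simp
  also have "m / (1 + m) < m"
    using m by (simp add: field_simps)
  then have "m / (1 + m) * power_tail \<kappa> a + a < m * power_tail \<kappa> a + a"
    using power_tail_pos[of \<kappa> a] assms by (intro add_strict_right_mono mult_strict_right_mono) auto
  finally show ?thesis
    by (simp add: m_def)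
qed

section \<open>Evaluation and comparison of the risks\<close>

lemma risk_underparametrized:
  assumes "0 < a" "a < \<beta>" "\<beta> < 1"
  shows "risk \<kappa> \<beta> N a = ereal (real N powr (1 - \<kappa>) * (power_tail \<kappa> a * (\<beta> / (\<beta> - a))))"
  using assms by (simp add: risk_def tail_integral_eq)

lemma risk_1:
  assumes "\<beta> < 1"
  shows "risk \<kappa> \<beta> N 1 = ereal (real N powr (1 - \<kappa>) * (\<beta> / m_sol \<kappa> \<beta> 1 0))"
proof -
  have "tail_integral \<kappa> 1 = 0"
    by (simp add: tail_integral_eq)
  then show ?thesis
    using assms by (simp add: risk_def)
qed

lemma risk_gt_critical:
  assumes "0 < \<kappa>" "\<beta> < 1" "0 < y" "y < \<beta>" "power_tail \<kappa> y = y powr (- \<kappa>) * (\<beta> - y)"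
    and "1 \<le> N" "0 \<le> x" "x < \<beta>" "x \<noteq> y"
  shows "risk \<kappa> \<beta> N y < risk \<kappa> \<beta> N x"
proof -
  define c where "c = real N powr (1 - \<kappa>)"
  have c: "0 < c"
    using assms by (simp add: c_def)
  \<comment> \<open>By the critical equation the tangent at \<open>y\<close> vanishes at \<beta>, so
    dividing it by \<open>\<beta> - x\<close> leaves a constant.\<close>
  have "power_tail \<kappa> y + y powr (- \<kappa>) * (y - x) = y powr (- \<kappa>) * (\<beta> - x)"
    using assms(5) by (simp add: algebra_simps)
  then have gt: "ereal (y powr (- \<kappa>) * (\<beta> - x)) < tail_integral \<kappa> x"
    using tail_integral_tangent[of \<kappa> x y] assms by simp
  have y: "risk \<kappa> \<beta> N y = ereal (c * (y powr (- \<kappa>) * \<beta>))"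
    using assms by (simp add: risk_underparametrized c_def)
  have x: "risk \<kappa> \<beta> N x = ereal c * (tail_integral \<kappa> x * ereal (\<beta> / (\<beta> - x)))"
    using assms by (simp add: risk_def c_def)
  show ?thesis
  proof (cases "tail_integral \<kappa> x")
    case (real r)
    then have "y powr (- \<kappa>) * (\<beta> - x) < r"
      using gt by simp
    then have "y powr (- \<kappa>) * (\<beta> - x) * (\<beta> / (\<beta> - x)) < r * (\<beta> / (\<beta> - x))"
      using assms by (intro mult_strict_right_mono) auto
    then have "y powr (- \<kappa>) * \<beta> < r * (\<beta> / (\<beta> - x))"
      using assms by simp
    then have "c * (y powr (- \<kappa>) * \<beta>) < c * (r * (\<beta> / (\<beta> - x)))"
      using c by (intro mult_strict_left_mono)
    then show ?thesis
      by (simp add: x y real)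
  next
    \<comment> \<open>This is the case \<open>x = 0\<close> with \<kappa> \<ge> 1.\<close>
    case PInf
    then show ?thesis
      using c assms by (simp add: x y)
  next
    case MInf
    then show ?thesis
      using gt by simp
  qed
qed

theorem theorem3:
  fixes \<kappa> \<beta> :: real
  assumes "\<kappa> > 0" and "0 < \<beta>" and "\<beta> < 1"
  shows "(\<forall>N\<ge>1. \<exists>!\<alpha>. is_arg_min (risk \<kappa> \<beta> N) (\<lambda>\<alpha>. \<alpha> \<in> {0..<\<beta>}) \<alpha>)
    \<and> limsup (\<lambda>N. risk \<kappa> \<beta> N 1 / risk \<kappa> \<beta> N (alpha_star \<kappa> \<beta> N)) < 1
    \<and> (\<forall>N\<ge>1. ((\<lambda>\<alpha>. risk \<kappa> \<beta> N \<alpha> / risk \<kappa> \<beta> N 1) \<longlongrightarrow> \<infinity>) (at_left \<beta>))"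
proof (intro conjI allI impI)
  obtain y where y: "0 < y" "y < \<beta>" "power_tail \<kappa> y = y powr (- \<kappa>) * (\<beta> - y)"
    using critical_point_exists[OF assms] by blast
  define m where "m = m_sol \<kappa> \<beta> 1 0"
  have m: "0 < m"
    using m_sol_1_0[OF assms] by (simp add: m_def)
  have arg_min_iff: "is_arg_min (risk \<kappa> \<beta> N) (\<lambda>\<alpha>. \<alpha> \<in> {0..<\<beta>}) a \<longleftrightarrow> a = y" if "1 \<le> N" for N a
    using risk_gt_critical[OF assms(1,3) y that] y
    unfolding is_arg_min_def by (metis atLeastLessThan_iff less_asym less_imp_le)
  show "\<exists>!\<alpha>. is_arg_min (risk \<kappa> \<beta> N) (\<lambda>\<alpha>. \<alpha> \<in> {0..<\<beta>}) \<alpha>" if "1 \<le> N" for N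
    using arg_min_iff[OF that] by simp
  \<comment> \<open>\<open>arg_min_on\<close> is a choice among the minimizers; uniqueness forces
    the value \<open>y\<close>, the same for every \<open>N \<ge> 1\<close>.\<close>
  have star: "alpha_star \<kappa> \<beta> N = y" if "1 \<le> N" for N
    unfolding alpha_star_def arg_min_on_def arg_min_def arg_min_iff[OF that] by simp

  \<comment> \<open>The quotient of \<open>\<beta> / m\<close> by the risk at \<open>y\<close>, with
    \<beta> and the power of \<open>N\<close> cancelled.\<close>
  define q where "q = (\<beta> - y) / (m * power_tail \<kappa> y)"
  have pos: "0 < power_tail \<kappa> y"
    using power_tail_pos y assms by simp
  have "q < 1"
    using less_m_sol_mult_power_tail[of \<kappa> \<beta> y] assms y m pos by (simp add: q_def m_def)
  have "risk \<kappa> \<beta> N 1 / risk \<kappa> \<beta> N (alpha_star \<kappa> \<beta> N) = ereal q" if "1 \<le> N" for N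
    using that assms y m pos
    by (simp add: star risk_1 risk_underparametrized q_def field_simps flip: m_def)
  \<comment> \<open>The ratio is constant from \<open>N = 1\<close> on; at \<open>N = 0\<close> the
    prefactor \<open>0 powr (1 - \<kappa>)\<close> is 0.\<close>
  then have "limsup (\<lambda>N. risk \<kappa> \<beta> N 1 / risk \<kappa> \<beta> N (alpha_star \<kappa> \<beta> N)) = limsup (\<lambda>N. ereal q)"
    by (intro Limsup_eq eventually_sequentiallyI[of 1])
  then show "limsup (\<lambda>N. risk \<kappa> \<beta> N 1 / risk \<kappa> \<beta> N (alpha_star \<kappa> \<beta> N)) < 1"
    using \<open>q < 1\<close> by (simp add: Limsup_const)

  show "((\<lambda>\<alpha>. risk \<kappa> \<beta> N \<alpha> / risk \<kappa> \<beta> N 1) \<longlongrightarrow> \<infinity>) (at_left \<beta>)" if "1 \<le> N" for N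
  proof -
    \<comment> \<open>After cancellation the ratio is
      \<open>power_tail \<kappa> \<alpha> * m / (\<beta> - \<alpha>)\<close>, whose numerator has a
      positive limit because \<beta> < 1.\<close>
    have "((\<lambda>\<alpha>. power_tail \<kappa> \<alpha> * m) \<longlongrightarrow> power_tail \<kappa> \<beta> * m) (at_left \<beta>)"
      using DERIV_isCont[OF DERIV_power_tail[OF assms(2)], of \<kappa>]
      by (intro tendsto_intros) (simp add: isCont_def filterlim_at_split)
    moreover have "0 < power_tail \<kappa> \<beta> * m"
      using power_tail_pos[of \<kappa> \<beta>] assms m by simp
    moreover have "filterlim (\<lambda>\<alpha>. 1 / (\<beta> - \<alpha>)) at_top (at_left \<beta>)"
      by real_asymp
    ultimately have "filterlim (\<lambda>\<alpha>. (power_tail \<kappa> \<alpha> * m) * (1 / (\<beta> - \<alpha>))) at_top (at_left \<beta>)"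
      by (rule filterlim_tendsto_pos_mult_at_top)
    then have "((\<lambda>\<alpha>. ereal (power_tail \<kappa> \<alpha> * m * (1 / (\<beta> - \<alpha>)))) \<longlongrightarrow> \<infinity>) (at_left \<beta>)"
      by (simp add: tendsto_PInfty_eq_at_top)
    \<comment> \<open>The closed form of the risk holds only for \<alpha> > 0.\<close>
    moreover have "\<forall>\<^sub>F \<alpha> in at_left \<beta>. 0 < \<alpha>"
      using assms by (intro order_tendstoD(1)[OF tendsto_ident_at]) auto
    then have "\<forall>\<^sub>F \<alpha> in at_left \<beta>. ereal (power_tail \<kappa> \<alpha> * m * (1 / (\<beta> - \<alpha>)))
        = risk \<kappa> \<beta> N \<alpha> / risk \<kappa> \<beta> N 1"
      using eventually_at_leftI[of "\<beta> - 1" \<beta> "\<lambda>\<alpha>. \<alpha> < \<beta>", simplified]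
    proof eventually_elim
      case (elim \<alpha>)
      then show ?case
        using that assms m by (simp add: risk_1 risk_underparametrized field_simps flip: m_def)
    qed
    ultimately show ?thesis
      by (rule Lim_transform_eventually)
  qed
qed

end
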